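(* For every $n\ge1$, the bias of the estimator $$\hat\theta_n^\sharp=w_0+\sum_{k=1}^K\hat p_k\sum_{v=1}^{n-x_k}w_v\prod_{j=1}^v\left(1-\frac{x_k-1}{n-j}\right)$$ of $\theta=\sum_{v=0}^\infty w_v\sum_{k=1}^Kp_k(1-p_k)^v$ decays at least exponentially fast in $n$: with $p_\wedge=\min\{p_k:1\le k\le K\}$, $$\left|\mathrm E\,\hat\theta_n^\sharp-\theta\right|=\left|\sum_{v=n}^\infty w_v\sum_{k=1}^Kp_k(1-p_k)^v\right|\le MK(1-p_\wedge)^n.$$
   Context: Let $\mathbf p=(p_1,\dots,p_K)$ be a probability distribution on letters $\ell_1,\dots,\ell_K$ with $K<\infty$ and $p_k>0$ for $k=1,\dots,K$. Let $\{w_v;v\ge0\}$ be real weights and $M>0$ with $|w_v|\le M$ for all $v\ge0$. Let $X_1,\dots,X_n$ be i.i.d. with $P(X_1=\ell_k)=p_k$, $x_k=\sum_{i=1}^n1[X_i=\ell_k]$ and $\hat p_k=x_k/n$. In $\hat\theta_n^\sharp$, the $k$-th summand is $0$ when $x_k=0$. The convention $0^0=1$ is used. *)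

theory Defs
  imports "HOL-Probability.Probability"
begin

definition letter_count :: "(nat \<Rightarrow> 'w \<Rightarrow> 'l) \<Rightarrow> nat \<Rightarrow> 'l \<Rightarrow> 'w \<Rightarrow> nat" where
  "letter_count X n a \<omega> = (\<Sum>i=1..n. of_bool (X i \<omega> = a))"

text \<open>When \<open>x = 0\<close> and \<open>v = n\<close> the product would contain a factor with denominator \<open>n - n\<close>;
  the summand is then \<open>0\<close> by convention.\<close>

definition theta_summand :: "(nat \<Rightarrow> real) \<Rightarrow> nat \<Rightarrow> nat \<Rightarrow> real" where
  "theta_summand w n x =
     (if x = 0 then 0
      else (real x / real n) *
           (\<Sum>v=1..n - x. w v * (\<Prod>j=1..v. 1 - (real x - 1) / (real n - real j))))"

definition theta_sharp ::
    "(nat \<Rightarrow> real) \<Rightarrow> nat \<Rightarrow> (nat \<Rightarrow> 'l) \<Rightarrow> (nat \<Rightarrow> 'w \<Rightarrow> 'l) \<Rightarrow> nat \<Rightarrow> 'w \<Rightarrow> real" where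
  "theta_sharp w K L X n \<omega> = w 0 + (\<Sum>k=1..K. theta_summand w n (letter_count X n (L k) \<omega>))"

definition theta_term :: "(nat \<Rightarrow> real) \<Rightarrow> nat \<Rightarrow> (nat \<Rightarrow> real) \<Rightarrow> nat \<Rightarrow> real" where
  "theta_term w K p v = w v * (\<Sum>k=1..K. p k * (1 - p k) ^ v)"

definition theta :: "(nat \<Rightarrow> real) \<Rightarrow> nat \<Rightarrow> (nat \<Rightarrow> real) \<Rightarrow> real" where
  "theta w K p = (\<Sum>v. theta_term w K p v)"

definition iid_sample :: "'w measure \<Rightarrow> 'l measure \<Rightarrow> (nat \<Rightarrow> 'w \<Rightarrow> 'l) \<Rightarrow> nat \<Rightarrow> bool" where
  "iid_sample \<Omega> S X n \<longleftrightarrow>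
     prob_space.indep_vars \<Omega> (\<lambda>_. S) X {1..n} \<and>
     (\<forall>i\<in>{1..n}. distr \<Omega> S (X i) = distr \<Omega> S (X 1))"

end

theory Submission
  imports Defs
begin

text \<open>For \<open>x \<ge> 1\<close> the product over \<open>j\<close> telescopes to a ratio of binomial coefficients, so that
  \<open>\<theta>\<close>-sharp is a combination of terms \<open>w v * Z k v\<close> with \<open>v < n\<close>. Since each letter count is
  binomially distributed, every \<open>Z k v\<close> is an unbiased estimator of \<open>p k * (1 - p k) ^ v\<close>.
  The bias is therefore minus the tail of the series from \<open>v = n\<close> on, which is bounded by a sum of
  geometric series.\<close>

text \<open>Factor \<open>j\<close> equals \<open>(n - x - (j - 1)) / (n - j)\<close>, so the
  product is a quotient of falling factorials, and the factorials \<open>v!\<close> cancel. For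
  \<open>x = 0\<close> the prefactor \<open>x / n\<close> reproduces the convention.\<close>

lemma theta_summand_binomial:
  assumes "n \<ge> 1" "x \<le> n"
  shows "theta_summand w n x =
    (\<Sum>v=1..n-1. w v * (real x / real n * (real ((n - x) choose v) / real ((n - 1) choose v))))"
proof (cases "x = 0")
  case False
  have prod_eq: "(\<Prod>j=1..v. 1 - (real x - 1) / (real n - real j)) =
      real ((n - x) choose v) / real ((n - 1) choose v)" if "v \<le> n - 1" for v
    using that
  proof (induction v)
    case (Suc v)
    \<comment> \<open>The subtraction is done in the reals, so the recurrence also holds for
      \<open>v > m\<close>, where both sides vanish. No lower bound on \<open>n - x\<close> is then
      needed.\<close>
    have step: "real (m choose Suc v) * real (Suc v) = real (m choose v) * (real m - real v)" for m
    proof (cases "v \<le> m")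
      case True
      then show ?thesis
        by (metis binomial_absorb_comp binomial_absorption mult.commute of_nat_diff of_nat_mult)
    qed (simp add: binomial_eq_0)
    have pos: "real ((n - 1) choose v) > 0" "real n - real (Suc v) > 0"
      using Suc.prems by (auto intro!: zero_less_binomial)
    have num: "real ((n - x) choose Suc v) =
        real ((n - x) choose v) * (real n - real x - real v) / real (Suc v)"
      using step[of "n - x"] assms by (simp add: field_simps of_nat_diff)
    have den: "real ((n - 1) choose Suc v) =
        real ((n - 1) choose v) * (real n - real (Suc v)) / real (Suc v)"
      using step[of "n - 1"] assms by (simp add: field_simps of_nat_diff)
    have "1 - (real x - 1) / (real n - real (Suc v)) =
        (real n - real x - real v) / (real n - real (Suc v))"
      using pos by (simp add: field_simps)
    then have "(\<Prod>j=1..Suc v. 1 - (real x - 1) / (real n - real j)) =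
        real ((n - x) choose v) / real ((n - 1) choose v) *
        ((real n - real x - real v) / (real n - real (Suc v)))"
      using Suc by simp
    also have "\<dots> = real ((n - x) choose Suc v) / real ((n - 1) choose Suc v)"
      unfolding num den by (simp del: of_nat_Suc)
    finally show ?case .
  qed simp
  have "(\<Sum>v=1..n - x. w v * (\<Prod>j=1..v. 1 - (real x - 1) / (real n - real j))) =
      (\<Sum>v=1..n - x. w v * (real ((n - x) choose v) / real ((n - 1) choose v)))"
    using False by (intro sum.cong refl arg_cong2[where f = "(*)"] prod_eq) auto
  \<comment> \<open>As \<open>x \<ge> 1\<close>, the range only grows, and the new terms have
    \<open>v > n - x\<close>, where the binomial coefficient is 0. The range no longer depends on
    the random count.\<close>
  also have "\<dots> = (\<Sum>v=1..n-1. w v * (real ((n - x) choose v) / real ((n - 1) choose v)))"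
    using False by (intro sum.mono_neutral_left) auto
  finally show ?thesis
    using False by (simp add: theta_summand_def sum_distrib_left mult_ac)
qed (simp add: theta_summand_def)

text \<open>For a probability \<open>p\<close>, the inner factor is the conditional probability,
  given \<open>x\<close> occurrences in \<open>n\<close> draws, that one fixed draw shows the letter
  and \<open>v\<close> other fixed draws do not; averaging gives \<open>p * (1 - p) ^ v\<close>. The
  proof is algebraic and works for every real \<open>p\<close>: absorption leaves the expansion of
  \<open>(p + (1 - p)) ^ (n - 1 - v)\<close>.\<close>

lemma binomial_factorial_moment:
  fixes p :: real
  assumes "n \<ge> 1" "v \<le> n - 1"
  shows "(\<Sum>x\<le>n. real (n choose x) * p ^ x * (1 - p) ^ (n - x) *
      (real x / real n * (real ((n - x) choose v) / real ((n - 1) choose v)))) = p * (1 - p) ^ v"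
proof -
  obtain m where n: "n = Suc m" using assms by (cases n) auto
  have v: "v \<le> m" using assms n by simp
  have ch: "real (m choose v) > 0" using v by simp
  let ?g = "\<lambda>x. real (n choose x) * p ^ x * (1 - p) ^ (n - x) *
      (real x / real n * (real ((n - x) choose v) / real ((n - 1) choose v)))"
  have "(\<Sum>x\<le>n. ?g x) = (\<Sum>y\<le>m. ?g (Suc y))"
    unfolding n by (subst sum.atMost_Suc_shift) simp
  \<comment> \<open>For \<open>y > m - v\<close> the coefficient \<open>(m - y) choose v\<close> is
    0.\<close>
  also have "\<dots> = (\<Sum>y\<le>m - v. ?g (Suc y))"
    using v n by (intro sum.mono_neutral_right) auto
  also have "\<dots> = (\<Sum>y\<le>m - v. p * (1 - p) ^ v *
      (real ((m - v) choose y) * p ^ y * (1 - p) ^ (m - v - y)))"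
  proof (intro sum.cong refl)
    fix y assume "y \<in> {..m - v}"
    then have y: "y \<le> m - v" by simp
    have a: "real (n choose Suc y) * (real (Suc y) / real n) = real (m choose y)"
    proof -
      have "real (Suc y) * real (n choose Suc y) = real n * real (m choose y)"
        unfolding n by (metis Suc_times_binomial of_nat_mult)
      then show ?thesis using n by (simp add: field_simps)
    qed
    \<comment> \<open>Both sides count the pairs of disjoint subsets of sizes \<open>y\<close> and
      \<open>v\<close> in a set of size \<open>m\<close>; the intermediate form chooses their union
      first.\<close>
    have "(m choose y) * ((m - y) choose v) = (m choose v) * ((m - v) choose y)"
    proof -
      have "(m choose y) * ((m - y) choose v) = (m choose (y + v)) * ((y + v) choose y)"
        using choose_mult[of y "y + v" m] y v by simp
      also have "\<dots> = (m choose (v + y)) * ((v + y) choose v)"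
        using binomial_symmetric[of y "y + v"] by (simp add: add.commute)
      also have "\<dots> = (m choose v) * ((m - v) choose y)"
        using choose_mult[of v "v + y" m] y v by simp
      finally show ?thesis .
    qed
    then have b: "real (m choose y) * real ((m - y) choose v) =
        real (m choose v) * real ((m - v) choose y)"
      by (metis of_nat_mult)
    have c: "(1 - p) ^ (m - y) = (1 - p) ^ v * (1 - p) ^ (m - v - y)"
      using y v by (simp flip: power_add)
    have "?g (Suc y) = (real (n choose Suc y) * (real (Suc y) / real n)) * real ((m - y) choose v)
        / real (m choose v) * p ^ Suc y * (1 - p) ^ (m - y)"
      by (simp add: n)
    also have "\<dots> = real ((m - v) choose y) * p ^ Suc y * (1 - p) ^ (m - y)"
      unfolding a b using ch by simp
    finally show "?g (Suc y) = p * (1 - p) ^ v *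
        (real ((m - v) choose y) * p ^ y * (1 - p) ^ (m - v - y))"
      by (simp add: c)
  qed
  also have "\<dots> = p * (1 - p) ^ v * (p + (1 - p)) ^ (m - v)"
    by (subst binomial_ring) (simp add: sum_distrib_left)
  finally show ?thesis by simp
qed

lemma sum_Pow_card:
  fixes g :: "nat \<Rightarrow> real"
  assumes "finite A"
  shows "(\<Sum>S\<in>Pow A. g (card S)) = (\<Sum>x\<le>card A. real (card A choose x) * g x)"
proof -
  have "(\<Sum>S\<in>Pow A. g (card S)) = (\<Sum>x\<le>card A. \<Sum>S\<in>{S\<in>Pow A. card S = x}. g (card S))"
    using assms by (intro sum.group[symmetric]) (auto intro: card_mono)
  also have "\<dots> = (\<Sum>x\<le>card A. real (card A choose x) * g x)"
    using assms by (intro sum.cong refl) (simp add: n_subsets)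
  finally show ?thesis .
qed

text \<open>The sample space is partitioned by the set of positions showing \<open>a\<close>.
  Independence gives each cell a product probability depending only on its cardinality, and
  \<open>sum_Pow_card\<close> collects equal cardinalities. The partition is finite, so every
  \<open>f\<close> is allowed.\<close>

lemma (in prob_space) letter_count_binomial:
  fixes f :: "nat \<Rightarrow> real"
  assumes indep: "indep_vars (\<lambda>_. count_space A) X {1..n}"
    and n: "n \<ge> 1" and a: "a \<in> A"
    and prob_eq: "\<And>i. i \<in> {1..n} \<Longrightarrow> prob {\<omega> \<in> space M. X i \<omega> = a} = p"
  shows "integrable M (\<lambda>\<omega>. f (letter_count X n a \<omega>))" (is ?int)
    and "expectation (\<lambda>\<omega>. f (letter_count X n a \<omega>)) =
      (\<Sum>x\<le>n. real (n choose x) * p ^ x * (1 - p) ^ (n - x) * f x)" (is ?exp)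
proof -
  \<comment> \<open>\<open>E S\<close> is the event that \<open>a\<close> occurs at exactly the
    positions in \<open>S\<close>. The intersection needs a nonempty index set, as an empty one
    would be the whole type; this is where \<open>n \<ge> 1\<close> enters.\<close>
  define B where "B S i = (if i \<in> S then {a} else A - {a})" for S and i :: nat
  define E where "E S = (\<Inter>i\<in>{1..n}. X i -` B S i \<inter> space M)" for S
  have meas: "X i \<in> measurable M (count_space A)" if "i \<in> {1..n}" for i
    using indep that by (auto simp: indep_vars_def)
  have B_sets: "B S i \<in> sets (count_space A)" for S i
    using a by (auto simp: B_def)
  have E_sets: "E S \<in> sets M" for S
    unfolding E_def using n by (intro sets.finite_INT measurable_sets[OF meas B_sets]) auto
  have single: "prob (X i -` B S i \<inter> space M) = (if i \<in> S then p else 1 - p)"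
    if i: "i \<in> {1..n}" for S i
  proof -
    have eq: "X i -` {a} \<inter> space M = {\<omega> \<in> space M. X i \<omega> = a}" by auto
    have ev: "X i -` {a} \<inter> space M \<in> events"
      using meas[OF i] a by (intro measurable_sets) auto
    have "X i -` (A - {a}) \<inter> space M = space M - (X i -` {a} \<inter> space M)"
      using measurable_space[OF meas[OF i]] by auto
    then show ?thesis
      using prob_compl[OF ev] prob_eq[OF i] eq by (simp add: B_def)
  qed
  have prob_E: "prob (E S) = p ^ card S * (1 - p) ^ (n - card S)" if S: "S \<in> Pow {1..n}" for S
  proof -
    have "prob (E S) = (\<Prod>i\<in>{1..n}. if i \<in> S then p else 1 - p)"
      unfolding E_def using n B_sets
      by (subst indep_varsD[OF indep]) (auto simp: single intro!: prod.cong)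
    also have "\<dots> = (\<Prod>i\<in>S. p) * (\<Prod>i\<in>{1..n} - S. 1 - p)"
      using S by (subst prod.If_cases) (auto intro!: arg_cong2[where f = "(*)"] simp: Int_absorb1 Diff_eq)
    also have "card ({1..n} - S) = n - card S"
      using S by (subst card_Diff_subset) (auto intro: finite_subset)
    then have "(\<Prod>i\<in>S. p) * (\<Prod>i\<in>{1..n} - S. 1 - p) = p ^ card S * (1 - p) ^ (n - card S)"
      by simp
    finally show ?thesis .
  qed
  have decomp: "f (letter_count X n a \<omega>) = (\<Sum>S\<in>Pow {1..n}. f (card S) * indicator (E S) \<omega>)"
    if \<omega>: "\<omega> \<in> space M" for \<omega>
  proof -
    define T where "T = {i\<in>{1..n}. X i \<omega> = a}"
    have cnt: "letter_count X n a \<omega> = card T"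
      unfolding letter_count_def T_def by (simp add: Int_def)
    \<comment> \<open>Each outcome lies in exactly one cell, so the sum over all \<open>S\<close>
      reduces to the term for \<open>T\<close>.\<close>
    have mem: "\<omega> \<in> E S \<longleftrightarrow> S = T" if "S \<in> Pow {1..n}" for S
    proof -
      have "X i \<omega> \<in> A" if "i \<in> {1..n}" for i
        using measurable_space[OF meas[OF that] \<omega>] by simp
      then have "\<omega> \<in> E S \<longleftrightarrow> (\<forall>i\<in>{1..n}. i \<in> S \<longleftrightarrow> X i \<omega> = a)"
        using \<omega> n by (fastforce simp: E_def B_def split: if_splits)
      then show ?thesis using that by (auto simp: T_def)
    qed
    have "(\<Sum>S\<in>Pow {1..n}. f (card S) * indicator (E S) \<omega>) =
        (\<Sum>S\<in>Pow {1..n}. if S = T then f (card T) else 0)"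
      by (intro sum.cong refl) (auto simp: mem indicator_def)
    also have "\<dots> = f (card T)" by (subst sum.delta) (auto simp: T_def)
    finally show ?thesis using cnt by simp
  qed
  have term_int: "integrable M (\<lambda>\<omega>. f (card S) * indicator (E S) \<omega>)" for S
    using E_sets by (simp add: less_top[symmetric])
  show ?int
    by (subst Bochner_Integration.integrable_cong[OF refl decomp])
      (auto intro!: Bochner_Integration.integrable_sum term_int simp del: sum_mult_indicator)
  have "expectation (\<lambda>\<omega>. f (letter_count X n a \<omega>)) =
      (\<Sum>S\<in>Pow {1..n}. expectation (\<lambda>\<omega>. f (card S) * indicator (E S) \<omega>))"
    by (subst Bochner_Integration.integral_cong[OF refl decomp])
      (assumption, rule Bochner_Integration.integral_sum[OF term_int])
  also have "\<dots> = (\<Sum>S\<in>Pow {1..n}. f (card S) * (p ^ card S * (1 - p) ^ (n - card S)))"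
    using E_sets by (intro sum.cong refl) (simp add: prob_E)
  also have "\<dots> = (\<Sum>x\<le>n. real (n choose x) * (f x * (p ^ x * (1 - p) ^ (n - x))))"
    using sum_Pow_card[of "{1..n}" "\<lambda>x. f x * (p ^ x * (1 - p) ^ (n - x))"] by simp
  finally show ?exp by (simp add: mult_ac)
qed

text \<open>Summability and integrability are part of the conclusion so that the series and the
  expectation are genuine values, not defaults of total operators. The shift \<open>v + n\<close>
  encodes a sum starting at \<open>n\<close>.\<close>

theorem mainTheorem3:
  fixes K n :: nat
    and p w :: "nat \<Rightarrow> real"
    and M :: real
    and L :: "nat \<Rightarrow> 'l"
    and \<Omega> :: "'w measure"
    and X :: "nat \<Rightarrow> 'w \<Rightarrow> 'l"
  assumes letters_distinct: "inj_on L {1..K}"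
    and p_pos: "\<And>k. k \<in> {1..K} \<Longrightarrow> p k > 0"
    and p_sum: "(\<Sum>k=1..K. p k) = 1"
    and M_pos: "M > 0"
    and w_bound: "\<And>v. \<bar>w v\<bar> \<le> M"
    and n_ge_1: "n \<ge> 1"
    and prob: "prob_space \<Omega>"
    and iid: "iid_sample \<Omega> (count_space (L ` {1..K})) X n"
    and law: "\<And>k. k \<in> {1..K} \<Longrightarrow> \<P>(\<omega> in \<Omega>. X 1 \<omega> = L k) = p k"
  shows "summable (theta_term w K p)
    \<and> integrable \<Omega> (theta_sharp w K L X n)
    \<and> \<bar>(\<integral>\<omega>. theta_sharp w K L X n \<omega> \<partial>\<Omega>) - theta w K p\<bar> = \<bar>\<Sum>v. theta_term w K p (v + n)\<bar>
    \<and> \<bar>\<Sum>v. theta_term w K p (v + n)\<bar> \<le> M * real K * (1 - Min (p ` {1..K})) ^ n"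
proof -
  interpret prob_space \<Omega> by (rule prob)
  let ?S = "count_space (L ` {1..K})"
  have indep: "indep_vars (\<lambda>_. ?S) X {1..n}"
    and distr: "\<And>i. i \<in> {1..n} \<Longrightarrow> distr \<Omega> ?S (X i) = distr \<Omega> ?S (X 1)"
    using iid unfolding iid_sample_def by blast+
  have meas: "X i \<in> measurable \<Omega> ?S" if "i \<in> {1..n}" for i
    using indep that by (auto simp: indep_vars_def)
  have prob_eq: "prob {\<omega> \<in> space \<Omega>. X i \<omega> = L k} = p k"
    if i: "i \<in> {1..n}" and k: "k \<in> {1..K}" for i k
  \<comment> \<open>\<open>law\<close> concerns \<open>X 1\<close> only; equality of the
    distributions, evaluated at \<open>{L k}\<close>, carries it to every
    \<open>X i\<close>.\<close>
  proof -
    have D: "measure (distr \<Omega> ?S (X j)) {L k} = prob {\<omega> \<in> space \<Omega>. X j \<omega> = L k}"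
      if "j \<in> {1..n}" for j
      using meas[OF that] k
      by (subst measure_distr) (auto intro!: arg_cong[where f = prob])
    show ?thesis using D[OF i] D[of 1] distr[OF i] law[OF k] n_ge_1 by simp
  qed
  have p_le: "p k \<le> 1" if "k \<in> {1..K}" for k
    using member_le_sum[of k "{1..K}" p] p_pos p_sum that by (auto intro: less_imp_le)
  have count_le: "letter_count X n a \<omega> \<le> n" for a \<omega>
    using sum_bounded_above[of "{1..n}" "\<lambda>i. of_bool (X i \<omega> = a)" "1::nat"]
    by (simp add: letter_count_def)
  \<comment> \<open>The estimator \<open>Z k v\<close> of the overview is \<open>c v\<close> applied
    to the count of \<open>L k\<close>.\<close>
  define c where "c v x = real x / real n * (real ((n - x) choose v) / real ((n - 1) choose v))" for v x
  have sharp: "theta_sharp w K L X n =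
      (\<lambda>\<omega>. w 0 + (\<Sum>k=1..K. \<Sum>v=1..n-1. w v * c v (letter_count X n (L k) \<omega>)))"
    unfolding theta_sharp_def c_def by (subst theta_summand_binomial[OF n_ge_1 count_le]) (rule refl)
  have int_c: "integrable \<Omega> (\<lambda>\<omega>. c v (letter_count X n (L k) \<omega>))"
    if "k \<in> {1..K}" for k v
    using that by (intro letter_count_binomial(1)[OF indep n_ge_1, where p = "p k"]) (auto intro: prob_eq)
  have exp_c: "expectation (\<lambda>\<omega>. c v (letter_count X n (L k) \<omega>)) = p k * (1 - p k) ^ v"
    if k: "k \<in> {1..K}" and v: "v \<le> n - 1" for k v
  proof -
    have "expectation (\<lambda>\<omega>. c v (letter_count X n (L k) \<omega>)) =
        (\<Sum>x\<le>n. real (n choose x) * p k ^ x * (1 - p k) ^ (n - x) * c v x)"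
      using k by (intro letter_count_binomial(2)[OF indep n_ge_1]) (auto intro: prob_eq)
    then show ?thesis
      using binomial_factorial_moment[OF n_ge_1 v] by (simp add: c_def)
  qed
  have integrable_sharp: "integrable \<Omega> (theta_sharp w K L X n)"
    unfolding sharp
    by (intro Bochner_Integration.integrable_add Bochner_Integration.integrable_sum
        integrable_mult_right int_c) auto
  have "expectation (theta_sharp w K L X n) =
      w 0 + (\<Sum>k=1..K. \<Sum>v=1..n-1. w v * (p k * (1 - p k) ^ v))"
    unfolding sharp
    by (subst Bochner_Integration.integral_add)
      (auto simp: Bochner_Integration.integral_sum int_c exp_c prob_space intro!: sum.cong)
  \<comment> \<open>The constant \<open>w 0\<close> is the term at \<open>v = 0\<close>, because the
    \<open>p k\<close> sum to 1.\<close>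
  also have "\<dots> = theta_term w K p 0 + (\<Sum>v=1..n-1. theta_term w K p v)"
    using p_sum by (subst sum.swap) (simp add: theta_term_def sum_distrib_left)
  also have "\<dots> = (\<Sum>v<n. theta_term w K p v)"
  proof -
    have "{..<n} = insert 0 {1..n-1}" using n_ge_1 by auto
    then show ?thesis by simp
  qed
  finally have expectation_sharp: "expectation (theta_sharp w K L X n) = (\<Sum>v<n. theta_term w K p v)" .

  \<comment> \<open>The factor \<open>p k\<close> cancels the geometric denominator
    \<open>1 - (1 - p k)\<close>. The case \<open>m = 0\<close> gives summability, and
    \<open>m = n\<close> bounds the tail.\<close>
  have geom: "(\<lambda>v. M * (\<Sum>k=1..K. p k * (1 - p k) ^ (v + m))) sums (M * (\<Sum>k=1..K. (1 - p k) ^ m))" for m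
  proof (intro sums_mult sums_sum)
    fix k assume k: "k \<in> {1..K}"
    have "(\<lambda>v. (p k * (1 - p k) ^ m) * (1 - p k) ^ v) sums ((p k * (1 - p k) ^ m) * (1 / (1 - (1 - p k))))"
      using p_pos[OF k] p_le[OF k] by (intro sums_mult geometric_sums) auto
    then show "(\<lambda>v. p k * (1 - p k) ^ (v + m)) sums (1 - p k) ^ m"
      using p_pos[OF k] by (simp add: power_add mult_ac)
  qed
  have term_bound: "norm (theta_term w K p v) \<le> M * (\<Sum>k=1..K. p k * (1 - p k) ^ v)" for v
  proof -
    have "0 \<le> (\<Sum>k=1..K. p k * (1 - p k) ^ v)"
      using p_pos p_le by (intro sum_nonneg mult_nonneg_nonneg zero_le_power) (auto intro: less_imp_le)
    then show ?thesis
      using w_bound[of v] by (auto simp: theta_term_def abs_mult intro: mult_right_mono)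
  qed
  have summable: "summable (theta_term w K p)"
    using summable_comparison_test'[OF sums_summable[OF geom[of 0]], of 0 "theta_term w K p"]
      term_bound unfolding add_0_right by blast
  have bias: "expectation (theta_sharp w K L X n) - theta w K p = - (\<Sum>v. theta_term w K p (v + n))"
    using suminf_split_initial_segment[OF summable, of n] expectation_sharp by (simp add: theta_def)
  have "\<bar>\<Sum>v. theta_term w K p (v + n)\<bar> \<le> M * (\<Sum>k=1..K. (1 - p k) ^ n)"
    using norm_suminf_le[OF term_bound sums_summable[OF geom[of n]]] sums_unique[OF geom[of n]]
    by simp
  \<comment> \<open>The smallest \<open>p k\<close> gives the largest base; \<open>p_le\<close>
    keeps the bases nonnegative, as monotonicity of powers requires.\<close>
  also have "\<dots> \<le> M * (\<Sum>k=1..K. (1 - Min (p ` {1..K})) ^ n)"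
    using M_pos p_le by (intro mult_left_mono sum_mono power_mono) auto
  finally have "\<bar>\<Sum>v. theta_term w K p (v + n)\<bar> \<le> M * real K * (1 - Min (p ` {1..K})) ^ n"
    by (simp add: mult.assoc)
  then show ?thesis
    using summable integrable_sharp bias by simp
qed

end
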